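(* Let $X$ be a closed subset of $[0,\infty)$ with the induced metric. Then every $a\in M(X)$ is a selfadjoint idempotent, i.e. $a^*=a$ and $a^2=a$. Hence $M(X)$ is commutative.
   Context: For a metric space $(X,d_X)$, write $x$ for $(x,0)$ and $x'$ for $(x,1)$ in $X\times\{0,1\}$. $\mathcal M(X)$ is the set of all metrics $d$ on $X\times\{0,1\}$ (metrics on the double of $X$) whose restriction to each of the two copies of $X$ equals $d_X$ and for which $\inf_{x,y\in X}d(x,y')>0$. Equivalence: $d_1\sim d_2$ if there exist $\alpha>0$, $\beta\ge 1$ with $-\alpha+\frac1\beta d_1(x,y')\le d_2(x,y')\le\alpha+\beta d_1(x,y')$ for all $x,y\in X$. $[d]$ is the class of $d$ and $M(X)=\mathcal M(X)/\sim$. Composition: for $\rho,d\in\mathcal M(X)$, $\rho d\in\mathcal M(X)$ is given by $\rho d(x,z')=\inf_{y\in X}[d(x,y')+\rho(y,z')]$. It is associative and respects $\sim$, so $M(X)$ is a semigroup with $[\rho][d]=[\rho d]$. The adjoint is $d^*(x,y')=d(y,x')$, and $[d]^*=[d^*]$ is a well-defined involution on $M(X)$. *)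

theory Defs
  imports "HOL-Analysis.Analysis"
begin

text \<open>
  Throughout, a metric space is a carrier \<open>X\<close> with a distance function \<open>dX\<close> such that
  \<^term>\<open>Metric_space X dX\<close>. The points \<open>x\<close> and \<open>x'\<close> of the double \<open>X \<times> {0,1}\<close> are
  \<open>(x,0)\<close> and \<open>(x,1)\<close>.
\<close>

text \<open>
  A function on pairs of points of \<open>X \<times> {0,1}\<close> is encoded as a total function that vanishes
  outside this set, so that it is determined by its values there. The infimum is taken in
  \<^typ>\<open>ereal\<close>, so that it is \<open>\<infinity>\<close> for empty \<open>X\<close>.
\<close>

definition double_metrics ::
    "'a set \<Rightarrow> ('a \<Rightarrow> 'a \<Rightarrow> real) \<Rightarrow> ('a \<times> nat \<Rightarrow> 'a \<times> nat \<Rightarrow> real) set" where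
  "double_metrics X dX = {d.
     Metric_space (X \<times> {0,1}) d \<and>
     (\<forall>p q. p \<notin> X \<times> {0,1} \<or> q \<notin> X \<times> {0,1} \<longrightarrow> d p q = 0) \<and>
     (\<forall>x\<in>X. \<forall>y\<in>X. d (x,0) (y,0) = dX x y \<and> d (x,1) (y,1) = dX x y) \<and>
     (INF x\<in>X. INF y\<in>X. ereal (d (x,0) (y,1))) > 0}"

definition double_equiv ::
    "'a set \<Rightarrow> ('a \<Rightarrow> 'a \<Rightarrow> real)
      \<Rightarrow> (('a \<times> nat \<Rightarrow> 'a \<times> nat \<Rightarrow> real) \<times> ('a \<times> nat \<Rightarrow> 'a \<times> nat \<Rightarrow> real)) set" where
  "double_equiv X dX = {(d1, d2).
     d1 \<in> double_metrics X dX \<and> d2 \<in> double_metrics X dX \<and>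
     (\<exists>\<alpha> \<beta>. \<alpha> > 0 \<and> \<beta> \<ge> 1 \<and> (\<forall>x\<in>X. \<forall>y\<in>X.
        - \<alpha> + (1 / \<beta>) * d1 (x,0) (y,1) \<le> d2 (x,0) (y,1) \<and>
        d2 (x,0) (y,1) \<le> \<alpha> + \<beta> * d1 (x,0) (y,1)))}"

definition double_classes ::
    "'a set \<Rightarrow> ('a \<Rightarrow> 'a \<Rightarrow> real) \<Rightarrow> ('a \<times> nat \<Rightarrow> 'a \<times> nat \<Rightarrow> real) set set" where
  "double_classes X dX = double_metrics X dX // double_equiv X dX"

text \<open>
  An element \<open>d\<close> of \<^const>\<open>double_metrics\<close> is determined by the values \<open>d(x,y')\<close>. The following
  builds the function on the double with prescribed values \<open>d(x,y') = f x y\<close>.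
\<close>

definition from_cross ::
    "'a set \<Rightarrow> ('a \<Rightarrow> 'a \<Rightarrow> real) \<Rightarrow> ('a \<Rightarrow> 'a \<Rightarrow> real) \<Rightarrow> 'a \<times> nat \<Rightarrow> 'a \<times> nat \<Rightarrow> real" where
  "from_cross X dX f p q =
     (if p \<in> X \<times> {0,1} \<and> q \<in> X \<times> {0,1} then
        (if snd p = snd q then dX (fst p) (fst q)
         else if snd p = 0 then f (fst p) (fst q)
         else f (fst q) (fst p))
      else 0)"

definition double_comp ::
    "'a set \<Rightarrow> ('a \<Rightarrow> 'a \<Rightarrow> real) \<Rightarrow> ('a \<times> nat \<Rightarrow> 'a \<times> nat \<Rightarrow> real)
      \<Rightarrow> ('a \<times> nat \<Rightarrow> 'a \<times> nat \<Rightarrow> real) \<Rightarrow> 'a \<times> nat \<Rightarrow> 'a \<times> nat \<Rightarrow> real" where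
  "double_comp X dX \<rho> d =
     from_cross X dX (\<lambda>x z. INF y\<in>X. d (x,0) (y,1) + \<rho> (y,0) (z,1))"

definition double_adjoint ::
    "'a set \<Rightarrow> ('a \<Rightarrow> 'a \<Rightarrow> real) \<Rightarrow> ('a \<times> nat \<Rightarrow> 'a \<times> nat \<Rightarrow> real)
      \<Rightarrow> 'a \<times> nat \<Rightarrow> 'a \<times> nat \<Rightarrow> real" where
  "double_adjoint X dX d = from_cross X dX (\<lambda>x y. d (y,0) (x,1))"

text \<open>
  The operations on classes, as unions over representatives; see \<open>class_mult_class\<close> and
  \<open>class_adjoint_class\<close> below for \<open>[\<rho>][d] = [\<rho>d]\<close> and \<open>[d]\<^sup>* = [d\<^sup>*]\<close>.
\<close>

definition class_mult ::
    "'a set \<Rightarrow> ('a \<Rightarrow> 'a \<Rightarrow> real) \<Rightarrow> ('a \<times> nat \<Rightarrow> 'a \<times> nat \<Rightarrow> real) set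
      \<Rightarrow> ('a \<times> nat \<Rightarrow> 'a \<times> nat \<Rightarrow> real) set \<Rightarrow> ('a \<times> nat \<Rightarrow> 'a \<times> nat \<Rightarrow> real) set" where
  "class_mult X dX a b = (\<Union>\<rho>\<in>a. \<Union>d\<in>b. double_equiv X dX `` {double_comp X dX \<rho> d})"

definition class_adjoint ::
    "'a set \<Rightarrow> ('a \<Rightarrow> 'a \<Rightarrow> real) \<Rightarrow> ('a \<times> nat \<Rightarrow> 'a \<times> nat \<Rightarrow> real) set
      \<Rightarrow> ('a \<times> nat \<Rightarrow> 'a \<times> nat \<Rightarrow> real) set" where
  "class_adjoint X dX a = (\<Union>d\<in>a. double_equiv X dX `` {double_adjoint X dX d})"

lemma INF_pos_iff:
  "(INF x\<in>X. INF y\<in>X. ereal (f x y)) > 0 \<longleftrightarrow> (\<exists>c>0. \<forall>x\<in>X. \<forall>y\<in>X. c \<le> f x y)"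
proof
  assume "(INF x\<in>X. INF y\<in>X. ereal (f x y)) > 0"
  then obtain c where c: "0 < ereal c" "ereal c < (INF x\<in>X. INF y\<in>X. ereal (f x y))"
    using ereal_dense2 by blast
  have "c \<le> f x y" if "x \<in> X" "y \<in> X" for x y
  proof -
    have "ereal c \<le> ereal (f x y)"
      using c(2) that by (meson INF_lower2 less_imp_le order.trans order_refl)
    then show ?thesis by simp
  qed
  with c(1) show "\<exists>c>0. \<forall>x\<in>X. \<forall>y\<in>X. c \<le> f x y" by auto
next
  assume "\<exists>c>0. \<forall>x\<in>X. \<forall>y\<in>X. c \<le> f x y"
  then obtain c where c: "c > 0" "\<forall>x\<in>X. \<forall>y\<in>X. c \<le> f x y" by auto
  then have "ereal c \<le> (INF x\<in>X. INF y\<in>X. ereal (f x y))"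
    by (intro INF_greatest) auto
  with c(1) show "(INF x\<in>X. INF y\<in>X. ereal (f x y)) > 0"
    by (metis ereal_less(2) less_le_trans)
qed

lemma from_cross_simps [simp]:
  assumes "x \<in> X" "y \<in> X"
  shows "from_cross X dX f (x,0) (y,0) = dX x y" "from_cross X dX f (x,Suc 0) (y,Suc 0) = dX x y"
    "from_cross X dX f (x,0) (y,Suc 0) = f x y" "from_cross X dX f (x,Suc 0) (y,0) = f y x"
  using assms by (auto simp: from_cross_def)

lemma from_cross_in_double_metrics:
  assumes M: "Metric_space X dX" and c: "c > 0" "\<And>x y. x \<in> X \<Longrightarrow> y \<in> X \<Longrightarrow> c \<le> f x y"
    and f1: "\<And>x y z. x \<in> X \<Longrightarrow> y \<in> X \<Longrightarrow> z \<in> X \<Longrightarrow> f x z \<le> dX x y + f y z"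
    and f2: "\<And>x y z. x \<in> X \<Longrightarrow> y \<in> X \<Longrightarrow> z \<in> X \<Longrightarrow> f x z \<le> f x y + dX y z"
    and f3: "\<And>x y z. x \<in> X \<Longrightarrow> y \<in> X \<Longrightarrow> z \<in> X \<Longrightarrow> dX x z \<le> f x y + f z y"
    and f4: "\<And>x y z. x \<in> X \<Longrightarrow> y \<in> X \<Longrightarrow> z \<in> X \<Longrightarrow> dX x z \<le> f y x + f y z"
  shows "from_cross X dX f \<in> double_metrics X dX"
proof -
  interpret Metric_space X dX by (rule M)
  have pos: "f x y > 0" if "x \<in> X" "y \<in> X" for x y
    using c that by (meson less_le_trans)
  have "Metric_space (X \<times> {0,1}) (from_cross X dX f)"
  proof
    show "0 \<le> from_cross X dX f p q" for p q
      using pos by (auto simp: from_cross_def less_imp_le)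
    show "from_cross X dX f p q = from_cross X dX f q p" for p q
      by (auto simp: from_cross_def commute)
    show "from_cross X dX f p q = 0 \<longleftrightarrow> p = q" if pq: "p \<in> X \<times> {0,1}" "q \<in> X \<times> {0,1}" for p q
    proof -
      obtain x i y j where e: "p = (x,i)" "q = (y,j)" "x \<in> X" "y \<in> X"
        and ij: "i = 0 \<or> i = Suc 0" "j = 0 \<or> j = Suc 0"
        using pq by auto
      show ?thesis
        using ij e(3,4) pos[OF e(3,4)] pos[OF e(4,3)] unfolding e(1,2) by (elim disjE) simp_all
    qed
    show "from_cross X dX f p r \<le> from_cross X dX f p q + from_cross X dX f q r"
      if pqr: "p \<in> X \<times> {0,1}" "q \<in> X \<times> {0,1}" "r \<in> X \<times> {0,1}" for p q r
    proof -
      obtain x i y j z k where e: "p = (x,i)" "q = (y,j)" "r = (z,k)" "x \<in> X" "y \<in> X" "z \<in> X"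
        and ijk: "i = 0 \<or> i = Suc 0" "j = 0 \<or> j = Suc 0" "k = 0 \<or> k = Suc 0"
        using pqr by auto
      have t: "dX x z \<le> dX x y + dX y z" "f x z \<le> dX x y + f y z" "f x z \<le> f x y + dX y z"
        "dX x z \<le> f x y + f z y" "dX x z \<le> f y x + f y z"
        "f z x \<le> f z y + dX x y" "f z x \<le> f y x + dX y z"
        using triangle[OF e(4-6)] f1[OF e(4-6)] f2[OF e(4-6)] f3[OF e(4-6)] f4[OF e(4-6)]
          f1[OF e(6,5,4)] f2[OF e(6,5,4)] commute[of x y] commute[of y z]
        by linarith+
      show ?thesis
        using ijk t e(4-6) unfolding e(1-3) by (elim disjE) (simp_all add: add.commute)
    qed
  qed
  moreover have "(INF x\<in>X. INF y\<in>X. ereal (from_cross X dX f (x,0) (y,1))) > 0"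
    unfolding INF_pos_iff using c by auto
  moreover have "from_cross X dX f p q = 0" if "p \<notin> X \<times> {0,1} \<or> q \<notin> X \<times> {0,1}" for p q
    using that unfolding from_cross_def by (simp only: de_Morgan_conj[symmetric] if_False if_not_P)
  ultimately show ?thesis by (auto simp: double_metrics_def simp del: mem_Sigma_iff)
qed

lemma double_metricsD:
  assumes "d \<in> double_metrics X dX" "x \<in> X" "y \<in> X" "z \<in> X"
  shows "0 \<le> d (x,0) (y,1)"
    "d (x,0) (z,1) \<le> dX x y + d (y,0) (z,1)"
    "d (x,0) (z,1) \<le> d (x,0) (y,1) + dX y z"
    "dX x z \<le> d (x,0) (y,1) + d (z,0) (y,1)"
    "dX x z \<le> d (y,0) (x,1) + d (y,0) (z,1)"
proof -
  interpret Metric_space "X \<times> {0,1}" d using assms(1) by (simp add: double_metrics_def)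
  have e: "d (u,0) (v,0) = dX u v" "d (u,1) (v,1) = dX u v" if "u \<in> X" "v \<in> X" for u v
    using assms(1) that by (auto simp: double_metrics_def)
  show "0 \<le> d (x,0) (y,1)" by simp
  show "d (x,0) (z,1) \<le> dX x y + d (y,0) (z,1)"
    using triangle[of "(x,0)" "(y,0)" "(z,1)"] e assms by simp
  show "d (x,0) (z,1) \<le> d (x,0) (y,1) + dX y z"
    using triangle[of "(x,0)" "(y,1)" "(z,1)"] e assms by simp
  show "dX x z \<le> d (x,0) (y,1) + d (z,0) (y,1)"
    using triangle[of "(x,0)" "(y,1)" "(z,0)"] e assms commute[of "(z,0)" "(y,1)"] by simp
  show "dX x z \<le> d (y,0) (x,1) + d (y,0) (z,1)"
    using triangle[of "(x,1)" "(y,0)" "(z,1)"] e[of x z] assms commute[of "(y,0)" "(x,1)"] by simp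
qed

lemma double_metrics_lower:
  assumes "d \<in> double_metrics X dX"
  obtains c where "c > 0" "\<And>x y. x \<in> X \<Longrightarrow> y \<in> X \<Longrightarrow> c \<le> d (x,0) (y,1)"
proof -
  from assms have "(INF x\<in>X. INF y\<in>X. ereal (d (x,0) (y,1))) > 0"
    by (simp only: double_metrics_def mem_Collect_eq)
  then show ?thesis
    unfolding INF_pos_iff using that by blast
qed

lemma double_adjoint_closed:
  assumes M: "Metric_space X dX" and d: "d \<in> double_metrics X dX"
  shows "double_adjoint X dX d \<in> double_metrics X dX"
proof -
  interpret Metric_space X dX by (rule M)
  obtain c where c: "c > 0" "\<And>x y. x \<in> X \<Longrightarrow> y \<in> X \<Longrightarrow> c \<le> d (x,0) (y,1)"
    using double_metrics_lower[OF d] by blast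
  show ?thesis
    unfolding double_adjoint_def
  proof (rule from_cross_in_double_metrics[OF M c(1)], goal_cases)
    case (1 x y) then show ?case by (intro c(2))
  next
    case (2 x y z) then show ?case using double_metricsD(3)[OF d, of z y x] commute[of x y] by simp
  next
    case (3 x y z) then show ?case using double_metricsD(2)[OF d, of z y x] commute[of y z] by simp
  next
    case (4 x y z) then show ?case using double_metricsD(5)[OF d, of x y z] by simp
  next
    case (5 x y z) then show ?case using double_metricsD(4)[OF d, of x y z] by simp
  qed
qed

lemma double_comp_cross:
  assumes "x \<in> X" "z \<in> X"
  shows "double_comp X dX \<rho> d (x,0) (z,1) = (INF y\<in>X. d (x,0) (y,1) + \<rho> (y,0) (z,1))"
  using assms by (simp add: double_comp_def)

lemma double_adjoint_cross:
  assumes "x \<in> X" "y \<in> X"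
  shows "double_adjoint X dX d (x,0) (y,1) = d (y,0) (x,1)"
  using assms by (simp add: double_adjoint_def)

lemma comp_lower:
  assumes "\<rho> \<in> double_metrics X dX" "d \<in> double_metrics X dX" "x \<in> X" "y \<in> X" "z \<in> X"
  shows "(INF y\<in>X. d (x,0) (y,1) + \<rho> (y,0) (z,1)) \<le> d (x,0) (y,1) + \<rho> (y,0) (z,1)"
proof (rule cINF_lower[OF _ assms(4)])
  show "bdd_below ((\<lambda>y. d (x,0) (y,1) + \<rho> (y,0) (z,1)) ` X)"
    by (rule bdd_belowI2[of _ 0])
       (rule add_nonneg_nonneg[OF double_metricsD(1)[OF assms(2,3) _ assms(3)]
          double_metricsD(1)[OF assms(1) _ assms(5,5)]])
qed

lemma double_comp_closed:
  assumes M: "Metric_space X dX" and r: "\<rho> \<in> double_metrics X dX"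
    and d: "d \<in> double_metrics X dX"
  shows "double_comp X dX \<rho> d \<in> double_metrics X dX"
proof -
  interpret Metric_space X dX by (rule M)
  obtain c where c: "c > 0" "\<And>x y. x \<in> X \<Longrightarrow> y \<in> X \<Longrightarrow> c \<le> d (x,0) (y,1)"
    using double_metrics_lower[OF d] by blast
  let ?f = "\<lambda>x z. INF y\<in>X. d (x,0) (y,1) + \<rho> (y,0) (z,1)"
  note low = comp_lower[OF r d]
  show ?thesis
    unfolding double_comp_def
  proof (rule from_cross_in_double_metrics[OF M c(1)], goal_cases)
    case (1 x y)
    have "c \<le> d (x,0) (u,1) + \<rho> (u,0) (y,1)" if "u \<in> X" for u
      using c(2)[OF 1(1) that] double_metricsD(1)[OF r that 1(2,2)] by linarith
    then show ?case using 1 by (intro cINF_greatest) auto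
  next
    case (2 x y z)
    have "?f x z - dX x y \<le> ?f y z"
    proof (rule cINF_greatest)
      fix u assume u: "u \<in> X"
      then show "?f x z - dX x y \<le> d (y,0) (u,1) + \<rho> (u,0) (z,1)"
        using low[of x u z] double_metricsD(2)[OF d, of x y u] 2 by simp
    qed (use 2 in auto)
    then show ?case by simp
  next
    case (3 x y z)
    have "?f x z - dX y z \<le> ?f x y"
    proof (rule cINF_greatest)
      fix u assume u: "u \<in> X"
      then show "?f x z - dX y z \<le> d (x,0) (u,1) + \<rho> (u,0) (y,1)"
        using low[of x u z] double_metricsD(3)[OF r, of u y z] 3 by simp
    qed (use 3 in auto)
    then show ?case by simp
  next
    case (4 x y z)
    have "dX x z - ?f z y \<le> ?f x y"
    proof (rule cINF_greatest)
      fix u assume u: "u \<in> X"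
      have "dX x z - (d (x,0) (u,1) + \<rho> (u,0) (y,1)) \<le> ?f z y"
      proof (rule cINF_greatest)
        fix v assume v: "v \<in> X"
        show "dX x z - (d (x,0) (u,1) + \<rho> (u,0) (y,1)) \<le> d (z,0) (v,1) + \<rho> (v,0) (y,1)"
          using double_metricsD(4)[OF d, of x u z] double_metricsD(4)[OF r, of u y v]
            double_metricsD(3)[OF d, of z v u] commute[of u v] u v 4 by simp
      qed (use 4 in auto)
      then show "dX x z - ?f z y \<le> d (x,0) (u,1) + \<rho> (u,0) (y,1)" by simp
    qed (use 4 in auto)
    then show ?case by simp
  next
    case (5 x y z)
    have "dX x z - ?f y z \<le> ?f y x"
    proof (rule cINF_greatest)
      fix u assume u: "u \<in> X"
      have "dX x z - (d (y,0) (u,1) + \<rho> (u,0) (x,1)) \<le> ?f y z"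
      proof (rule cINF_greatest)
        fix v assume v: "v \<in> X"
        show "dX x z - (d (y,0) (u,1) + \<rho> (u,0) (x,1)) \<le> d (y,0) (v,1) + \<rho> (v,0) (z,1)"
          using double_metricsD(5)[OF r, of x u z] double_metricsD(5)[OF d, of u y v]
            double_metricsD(2)[OF r, of u v z] u v 5 by simp
      qed (use 5 in auto)
      then show "dX x z - ?f y z \<le> d (y,0) (u,1) + \<rho> (u,0) (x,1)" by simp
    qed (use 5 in auto)
    then show ?case by simp
  qed
qed

lemma double_equivI:
  assumes "d1 \<in> double_metrics X dX" "d2 \<in> double_metrics X dX" "\<alpha> > 0" "\<beta> \<ge> 1"
    and "\<And>x y. x \<in> X \<Longrightarrow> y \<in> X \<Longrightarrow> d2 (x,0) (y,1) \<le> \<alpha> + \<beta> * d1 (x,0) (y,1)"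
    and "\<And>x y. x \<in> X \<Longrightarrow> y \<in> X \<Longrightarrow> d1 (x,0) (y,1) \<le> \<alpha> + \<beta> * d2 (x,0) (y,1)"
  shows "(d1, d2) \<in> double_equiv X dX"
proof -
  have "- \<alpha> + (1 / \<beta>) * d1 (x,0) (y,1) \<le> d2 (x,0) (y,1)" if "x \<in> X" "y \<in> X" for x y
  proof -
    have "(1 / \<beta>) * d1 (x,0) (y,1) \<le> (1 / \<beta>) * (\<alpha> + \<beta> * d2 (x,0) (y,1))"
      using assms(4) assms(6)[OF that] by (intro mult_left_mono) auto
    also have "\<dots> = \<alpha> / \<beta> + d2 (x,0) (y,1)" using assms(4) by (simp add: field_simps)
    also have "\<alpha> / \<beta> \<le> \<alpha>" using assms(3,4) by (simp add: field_simps)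
    finally show ?thesis by simp
  qed
  with assms(1-5) show ?thesis unfolding double_equiv_def by blast
qed

lemma double_equivE:
  assumes "(d1, d2) \<in> double_equiv X dX"
  obtains \<alpha> \<beta> where "d1 \<in> double_metrics X dX" "d2 \<in> double_metrics X dX" "\<alpha> > 0" "\<beta> \<ge> 1"
    "\<And>x y. x \<in> X \<Longrightarrow> y \<in> X \<Longrightarrow> d2 (x,0) (y,1) \<le> \<alpha> + \<beta> * d1 (x,0) (y,1)"
    "\<And>x y. x \<in> X \<Longrightarrow> y \<in> X \<Longrightarrow> d1 (x,0) (y,1) \<le> \<alpha> + \<beta> * d2 (x,0) (y,1)"
proof -
  obtain \<alpha> \<beta> where d: "d1 \<in> double_metrics X dX" "d2 \<in> double_metrics X dX"
    and ab: "\<alpha> > 0" "\<beta> \<ge> 1" and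
    h: "\<And>x y. x \<in> X \<Longrightarrow> y \<in> X \<Longrightarrow> - \<alpha> + (1 / \<beta>) * d1 (x,0) (y,1) \<le> d2 (x,0) (y,1) \<and>
        d2 (x,0) (y,1) \<le> \<alpha> + \<beta> * d1 (x,0) (y,1)"
    using assms unfolding double_equiv_def by blast
  have p: "\<alpha> \<le> \<beta> * \<alpha>" using ab by simp
  show ?thesis
  proof (rule that[OF d, of "\<beta> * \<alpha>" \<beta>])
    fix x y assume xy: "x \<in> X" "y \<in> X"
    show "d2 (x,0) (y,1) \<le> \<beta> * \<alpha> + \<beta> * d1 (x,0) (y,1)" using h[OF xy] p by simp
    have "\<beta> * (- \<alpha> + (1 / \<beta>) * d1 (x,0) (y,1)) \<le> \<beta> * d2 (x,0) (y,1)"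
      using h[OF xy] ab by (intro mult_left_mono) auto
    then show "d1 (x,0) (y,1) \<le> \<beta> * \<alpha> + \<beta> * d2 (x,0) (y,1)"
      using ab by (simp add: algebra_simps)
  qed (use ab in auto)
qed

lemma equiv_double_equiv: "equiv (double_metrics X dX) (double_equiv X dX)"
proof (rule equivI)
  show "double_equiv X dX \<subseteq> double_metrics X dX \<times> double_metrics X dX"
    by (auto simp: double_equiv_def)
  show "refl_on (double_metrics X dX) (double_equiv X dX)"
    by (rule refl_onI) (rule double_equivI[where \<alpha>=1 and \<beta>=1], auto)
  show "sym (double_equiv X dX)"
  proof (rule symI)
    fix d1 d2 assume "(d1, d2) \<in> double_equiv X dX"
    then show "(d2, d1) \<in> double_equiv X dX"
    proof (rule double_equivE)
      fix \<alpha> \<beta> assume h: "d1 \<in> double_metrics X dX" "d2 \<in> double_metrics X dX" "0 < \<alpha>" "1 \<le> \<beta>"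
        "\<And>x y. x \<in> X \<Longrightarrow> y \<in> X \<Longrightarrow> d2 (x,0) (y,1) \<le> \<alpha> + \<beta> * d1 (x,0) (y,1)"
        "\<And>x y. x \<in> X \<Longrightarrow> y \<in> X \<Longrightarrow> d1 (x,0) (y,1) \<le> \<alpha> + \<beta> * d2 (x,0) (y,1)"
      show ?thesis by (rule double_equivI[OF h(2,1,3,4,6,5)])
    qed
  qed
  show "trans (double_equiv X dX)"
  proof (rule transI)
    fix d1 d2 d3 assume "(d1, d2) \<in> double_equiv X dX" "(d2, d3) \<in> double_equiv X dX"
    from this(1) obtain \<alpha> \<beta> where 1: "d1 \<in> double_metrics X dX" "\<alpha> > 0" "\<beta> \<ge> 1"
      "\<And>x y. x \<in> X \<Longrightarrow> y \<in> X \<Longrightarrow> d2 (x,0) (y,1) \<le> \<alpha> + \<beta> * d1 (x,0) (y,1)"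
      "\<And>x y. x \<in> X \<Longrightarrow> y \<in> X \<Longrightarrow> d1 (x,0) (y,1) \<le> \<alpha> + \<beta> * d2 (x,0) (y,1)"
      by (rule double_equivE) blast
    from \<open>(d2, d3) \<in> _\<close> obtain \<alpha>' \<beta>' where 2: "d3 \<in> double_metrics X dX" "\<alpha>' > 0" "\<beta>' \<ge> 1"
      "\<And>x y. x \<in> X \<Longrightarrow> y \<in> X \<Longrightarrow> d3 (x,0) (y,1) \<le> \<alpha>' + \<beta>' * d2 (x,0) (y,1)"
      "\<And>x y. x \<in> X \<Longrightarrow> y \<in> X \<Longrightarrow> d2 (x,0) (y,1) \<le> \<alpha>' + \<beta>' * d3 (x,0) (y,1)"
      by (rule double_equivE) blast
    show "(d1, d3) \<in> double_equiv X dX"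
    proof (rule double_equivI[where \<alpha> = "\<alpha> + \<alpha>' + \<beta>' * \<alpha> + \<beta> * \<alpha>'" and \<beta> = "\<beta> * \<beta>'"])
      show "\<alpha> + \<alpha>' + \<beta>' * \<alpha> + \<beta> * \<alpha>' > 0" using 1 2 by (simp add: add_pos_pos)
      show "1 \<le> \<beta> * \<beta>'" using 1(3) 2(3) mult_mono[of 1 \<beta> 1 \<beta>'] by simp
      fix x y assume xy: "x \<in> X" "y \<in> X"
      have p: "0 \<le> \<beta>' * \<alpha>" "0 \<le> \<beta> * \<alpha>'" using 1 2 by auto
      have "\<beta>' * d2 (x,0) (y,1) \<le> \<beta>' * (\<alpha> + \<beta> * d1 (x,0) (y,1))"
        using 1(4)[OF xy] 2(3) by (intro mult_left_mono) auto
      then show "d3 (x,0) (y,1) \<le> \<alpha> + \<alpha>' + \<beta>' * \<alpha> + \<beta> * \<alpha>' + \<beta> * \<beta>' * d1 (x,0) (y,1)"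
        using 2(4)[OF xy] p 1(2) by (simp add: algebra_simps)
      have "\<beta> * d2 (x,0) (y,1) \<le> \<beta> * (\<alpha>' + \<beta>' * d3 (x,0) (y,1))"
        using 2(5)[OF xy] 1(3) by (intro mult_left_mono) auto
      then show "d1 (x,0) (y,1) \<le> \<alpha> + \<alpha>' + \<beta>' * \<alpha> + \<beta> * \<alpha>' + \<beta> * \<beta>' * d3 (x,0) (y,1)"
        using 1(5)[OF xy] p 2(2) by (simp add: algebra_simps)
    qed (use 1 2 in auto)
  qed
qed

lemma double_adjoint_cong:
  assumes "Metric_space X dX" "(d1, d2) \<in> double_equiv X dX"
  shows "(double_adjoint X dX d1, double_adjoint X dX d2) \<in> double_equiv X dX"
  using assms(2)
proof (rule double_equivE)
  fix \<alpha> \<beta> assume h: "d1 \<in> double_metrics X dX" "d2 \<in> double_metrics X dX" "0 < \<alpha>" "1 \<le> \<beta>"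
    "\<And>x y. x \<in> X \<Longrightarrow> y \<in> X \<Longrightarrow> d2 (x,0) (y,1) \<le> \<alpha> + \<beta> * d1 (x,0) (y,1)"
    "\<And>x y. x \<in> X \<Longrightarrow> y \<in> X \<Longrightarrow> d1 (x,0) (y,1) \<le> \<alpha> + \<beta> * d2 (x,0) (y,1)"
  show ?thesis
    by (rule double_equivI[OF double_adjoint_closed double_adjoint_closed h(3,4)])
       (simp_all only: double_adjoint_cross h assms(1))
qed

lemma double_comp_mono:
  assumes r: "\<rho>1 \<in> double_metrics X dX" "\<rho>2 \<in> double_metrics X dX"
    and d: "d1 \<in> double_metrics X dX" "d2 \<in> double_metrics X dX"
    and xz: "x \<in> X" "z \<in> X"
    and a: "0 < \<alpha>" "1 \<le> \<beta>"
      "\<And>x y. x \<in> X \<Longrightarrow> y \<in> X \<Longrightarrow> \<rho>2 (x,0) (y,1) \<le> \<alpha> + \<beta> * \<rho>1 (x,0) (y,1)"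
    and b: "0 < \<alpha>'" "1 \<le> \<beta>'"
      "\<And>x y. x \<in> X \<Longrightarrow> y \<in> X \<Longrightarrow> d2 (x,0) (y,1) \<le> \<alpha>' + \<beta>' * d1 (x,0) (y,1)"
  shows "double_comp X dX \<rho>2 d2 (x,0) (z,1)
    \<le> (\<alpha> + \<alpha>') + (\<beta> * \<beta>') * double_comp X dX \<rho>1 d1 (x,0) (z,1)"
proof -
  let ?f = "\<lambda>\<rho> d. INF y\<in>X. d (x,0) (y,1) + \<rho> (y,0) (z,1)"
  have bb: "0 < \<beta> * \<beta>'" "\<beta> \<le> \<beta> * \<beta>'" "\<beta>' \<le> \<beta> * \<beta>'" using a b by auto
  have "(?f \<rho>2 d2 - (\<alpha> + \<alpha>')) / (\<beta> * \<beta>') \<le> ?f \<rho>1 d1"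
  proof (rule cINF_greatest)
    fix y assume y: "y \<in> X"
    have "\<beta> * \<rho>1 (y,0) (z,1) \<le> (\<beta> * \<beta>') * \<rho>1 (y,0) (z,1)"
      using bb double_metricsD(1)[OF r(1) y xz(2) xz(2)] by (intro mult_right_mono)
    moreover have "\<beta>' * d1 (x,0) (y,1) \<le> (\<beta> * \<beta>') * d1 (x,0) (y,1)"
      using bb double_metricsD(1)[OF d(1) xz(1) y y] by (intro mult_right_mono)
    ultimately have "?f \<rho>2 d2 - (\<alpha> + \<alpha>') \<le> (\<beta> * \<beta>') * (d1 (x,0) (y,1) + \<rho>1 (y,0) (z,1))"
      using comp_lower[OF r(2) d(2) xz(1) y xz(2)] a(3)[OF y xz(2)] b(3)[OF xz(1) y]
      unfolding distrib_left by linarith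
    then show "(?f \<rho>2 d2 - (\<alpha> + \<alpha>')) / (\<beta> * \<beta>') \<le> d1 (x,0) (y,1) + \<rho>1 (y,0) (z,1)"
      using bb by (simp only: pos_divide_le_eq mult.commute)
  qed (use xz in auto)
  then show ?thesis
    unfolding double_comp_cross[OF xz] pos_divide_le_eq[OF bb(1)] by (simp add: algebra_simps)
qed

lemma double_comp_cong:
  assumes M: "Metric_space X dX" and r: "(\<rho>1, \<rho>2) \<in> double_equiv X dX"
    and d: "(d1, d2) \<in> double_equiv X dX"
  shows "(double_comp X dX \<rho>1 d1, double_comp X dX \<rho>2 d2) \<in> double_equiv X dX"
  using r
proof (rule double_equivE)
  fix \<alpha> \<beta> assume h: "\<rho>1 \<in> double_metrics X dX" "\<rho>2 \<in> double_metrics X dX" "0 < \<alpha>" "1 \<le> \<beta>"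
    "\<And>x y. x \<in> X \<Longrightarrow> y \<in> X \<Longrightarrow> \<rho>2 (x,0) (y,1) \<le> \<alpha> + \<beta> * \<rho>1 (x,0) (y,1)"
    "\<And>x y. x \<in> X \<Longrightarrow> y \<in> X \<Longrightarrow> \<rho>1 (x,0) (y,1) \<le> \<alpha> + \<beta> * \<rho>2 (x,0) (y,1)"
  show ?thesis
    using d
  proof (rule double_equivE)
    fix \<alpha>' \<beta>' assume k: "d1 \<in> double_metrics X dX" "d2 \<in> double_metrics X dX" "0 < \<alpha>'" "1 \<le> \<beta>'"
      "\<And>x y. x \<in> X \<Longrightarrow> y \<in> X \<Longrightarrow> d2 (x,0) (y,1) \<le> \<alpha>' + \<beta>' * d1 (x,0) (y,1)"
      "\<And>x y. x \<in> X \<Longrightarrow> y \<in> X \<Longrightarrow> d1 (x,0) (y,1) \<le> \<alpha>' + \<beta>' * d2 (x,0) (y,1)"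
    show ?thesis
    proof (rule double_equivI[where \<alpha> = "\<alpha> + \<alpha>'" and \<beta> = "\<beta> * \<beta>'"])
      show "1 \<le> \<beta> * \<beta>'" using h(4) k(4) mult_mono[of 1 \<beta> 1 \<beta>'] by simp
      show "double_comp X dX \<rho>1 d1 \<in> double_metrics X dX" "double_comp X dX \<rho>2 d2 \<in> double_metrics X dX"
        using double_comp_closed[OF M] h(1,2) k(1,2) by blast+
      show "0 < \<alpha> + \<alpha>'" using h(3) k(3) by simp
    next
      fix x y assume xy: "x \<in> X" "y \<in> X"
      show "double_comp X dX \<rho>2 d2 (x,0) (y,1)
          \<le> (\<alpha> + \<alpha>') + (\<beta> * \<beta>') * double_comp X dX \<rho>1 d1 (x,0) (y,1)"
        by (rule double_comp_mono[OF h(1,2) k(1,2) xy h(3-5) k(3-5)])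
      show "double_comp X dX \<rho>1 d1 (x,0) (y,1)
          \<le> (\<alpha> + \<alpha>') + (\<beta> * \<beta>') * double_comp X dX \<rho>2 d2 (x,0) (y,1)"
        by (rule double_comp_mono[OF h(2,1) k(2,1) xy h(3,4,6) k(3,4,6)])
    qed
  qed
qed

lemma class_mult_class:
  assumes M: "Metric_space X dX" and r: "\<rho> \<in> double_metrics X dX"
    and d: "d \<in> double_metrics X dX"
  shows "class_mult X dX (double_equiv X dX `` {\<rho>}) (double_equiv X dX `` {d})
    = double_equiv X dX `` {double_comp X dX \<rho> d}"
proof -
  note E = equiv_double_equiv[of X dX]
  have "congruent2 (double_equiv X dX) (double_equiv X dX)
      (\<lambda>\<rho> d. double_equiv X dX `` {double_comp X dX \<rho> d})"
    by (rule congruent2I') (rule equiv_class_eq[OF E double_comp_cong[OF M]])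
  from UN_equiv_class2[OF E E this r d] show ?thesis
    unfolding class_mult_def .
qed

lemma class_adjoint_class:
  assumes M: "Metric_space X dX" and d: "d \<in> double_metrics X dX"
  shows "class_adjoint X dX (double_equiv X dX `` {d})
    = double_equiv X dX `` {double_adjoint X dX d}"
proof -
  note E = equiv_double_equiv[of X dX]
  have "(\<lambda>d. double_equiv X dX `` {double_adjoint X dX d}) respects double_equiv X dX"
    by (rule congruentI) (rule equiv_class_eq[OF E double_adjoint_cong[OF M]])
  from UN_equiv_class[OF E this d] show ?thesis
    unfolding class_adjoint_def .
qed

end

theory Submission
  imports Defs
begin

text \<open>
  Fix \<open>x\<^sub>0 \<in> X\<close>. Since \<open>X\<close> is bounded below, \<open>\<bar>x - y\<bar>\<close> differs by at most a constant from
  \<open>\<bar>dist x x\<^sub>0 - dist y x\<^sub>0\<bar>\<close>, and the latter is at most \<open>d(x,y') + d(x\<^sub>0,x\<^sub>0')\<close>. Hence every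
  \<open>d \<in> \<M>(X)\<close> satisfies \<open>dist x y \<le> d(x,y') + C\<close>. This estimate compares \<open>d(x,y')\<close> with \<open>d(y,x')\<close>
  and with \<open>d(x,y') + d(y,z')\<close> through the triangle inequality. Commutativity follows, as in any
  involutive semigroup of selfadjoint elements: \<open>ab = (ab)\<^sup>* = b\<^sup>*a\<^sup>* = ba\<close>.
\<close>

lemma half_line_dist_le_cross:
  fixes X :: "real set"
  assumes X: "X \<subseteq> {0..}" and d: "d \<in> double_metrics X dist"
  obtains C where "C > 0" "\<And>x y. x \<in> X \<Longrightarrow> y \<in> X \<Longrightarrow> dist x y \<le> d (x,0) (y,1) + C"
proof (cases "X = {}")
  case False
  then obtain x0 where x0: "x0 \<in> X" by blast
  have nonneg: "0 \<le> x" if "x \<in> X" for x using X that by auto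
  \<comment> \<open>The term \<open>2 * x0\<close> pays for points on opposite sides of
    \<open>x0\<close>: if x \<le> x0 \<le> y, then y - x exceeds x + y - 2 x0 by 2 (x0 - x) \<le> 2
    x0, as x is nonnegative.\<close>
  have "dist x y \<le> d (x,0) (y,1) + (d (x0,0) (x0,1) + 2 * x0 + 1)" if "x \<in> X" "y \<in> X" for x y
  proof -
    \<comment> \<open>The route is x, y', x0', x0; the bound after it follows y', x, x0,
      x0'.\<close>
    have "dist x x0 \<le> d (x,0) (y,1) + d (x0,0) (x0,1) + dist y x0"
      using double_metricsD(4)[OF d, of x y x0] double_metricsD(3)[OF d, of x0 x0 y] that x0
      by (simp add: dist_commute)
    moreover have "dist y x0 \<le> d (x,0) (y,1) + d (x0,0) (x0,1) + dist x x0"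
      using double_metricsD(5)[OF d, of y x x0] double_metricsD(2)[OF d, of x x0 x0] that x0
      by simp
    ultimately show ?thesis
      using nonneg[OF that(1)] nonneg[OF that(2)] nonneg[OF x0] unfolding dist_real_def by argo
  qed
  moreover have "d (x0,0) (x0,1) + 2 * x0 + 1 > 0"
    using double_metricsD(1)[OF d x0 x0 x0] nonneg[OF x0] by linarith
  ultimately show ?thesis using that by blast
qed (use that[of 1] in auto)

lemma double_adjoint_equiv_self:
  assumes M: "Metric_space X dX" and d: "d \<in> double_metrics X dX" and C: "C > 0"
    and le: "\<And>x y. x \<in> X \<Longrightarrow> y \<in> X \<Longrightarrow> dX x y \<le> d (x,0) (y,1) + C"
  shows "(double_adjoint X dX d, d) \<in> double_equiv X dX"
proof -
  interpret Metric_space X dX by (rule M)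
  \<comment> \<open>The route y, x, y', x' contains the distance from x to y twice, each at most
    d(x,y') + C. The bound is symmetric in the two orders, so it serves both directions of the
    equivalence.\<close>
  have swap: "d (y,0) (x,1) \<le> 2 * C + 3 * d (x,0) (y,1)" if "x \<in> X" "y \<in> X" for x y
    using double_metricsD(2)[OF d, of y x x] double_metricsD(3)[OF d, of x y x]
      commute[of x y] le[OF that] that by linarith
  show ?thesis
  proof (rule double_equivI[OF double_adjoint_closed[OF M d] d, of "2 * C" 3])
    show "0 < 2 * C" using C by simp
  qed (simp_all only: double_adjoint_cross swap)
qed

lemma double_comp_self_equiv:
  assumes M: "Metric_space X dX" and d: "d \<in> double_metrics X dX" and C: "C > 0"
    and le: "\<And>x y. x \<in> X \<Longrightarrow> y \<in> X \<Longrightarrow> dX x y \<le> d (x,0) (y,1) + C"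
  shows "(double_comp X dX d d, d) \<in> double_equiv X dX"
proof (rule double_equivI[OF double_comp_closed[OF M d d] d C, of 3])
  interpret Metric_space X dX by (rule M)
  fix x z assume xz: "x \<in> X" "z \<in> X"
  have "d (x,0) (z,1) - C \<le> double_comp X dX d d (x,0) (z,1)"
    unfolding double_comp_cross[OF xz]
  proof (rule cINF_greatest)
    \<comment> \<open>The route x, y', z' is used, and \<open>le\<close> trades the distance from y
      to z for d(y,z') + C.\<close>
    fix y assume "y \<in> X"
    then show "d (x,0) (z,1) - C \<le> d (x,0) (y,1) + d (y,0) (z,1)"
      using double_metricsD(3)[OF d, of x y z] le[of y z] xz by linarith
  qed (use xz in auto)
  moreover have "0 \<le> double_comp X dX d d (x,0) (z,1)"
    by (rule double_metricsD(1)[OF double_comp_closed[OF M d d] xz xz(1)])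
  ultimately show "d (x,0) (z,1) \<le> C + 3 * double_comp X dX d d (x,0) (z,1)"
    by linarith
  \<comment> \<open>The midpoint y = x is chosen in the infimum; then d(x,x') \<le> d(x,z') + dX z x
    \<le> 2 d(x,z') + C, whence the factor 3.\<close>
  have "double_comp X dX d d (x,0) (z,1) \<le> d (x,0) (x,1) + d (x,0) (z,1)"
    unfolding double_comp_cross[OF xz] by (rule comp_lower[OF d d xz(1,1,2)])
  then show "double_comp X dX d d (x,0) (z,1) \<le> C + 3 * d (x,0) (z,1)"
    using double_metricsD(3)[OF d, of x z x] commute[of x z] le[OF xz] xz by linarith
qed simp

text \<open>For each midpoint y, reversing the path swaps the two summands, so both infima run over
  the same sums.\<close>

lemma double_adjoint_comp:
  "double_adjoint X dX (double_comp X dX \<rho> d)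
    = double_comp X dX (double_adjoint X dX d) (double_adjoint X dX \<rho>)"
proof (intro ext)
  fix p q
  have "double_comp X dX \<rho> d (z,0) (x,1)
      = (INF y\<in>X. double_adjoint X dX \<rho> (x,0) (y,1) + double_adjoint X dX d (y,0) (z,1))"
    if "x \<in> X" "z \<in> X" for x z
    unfolding double_comp_cross[OF that(2,1)]
    using that by (intro INF_cong) (simp_all only: double_adjoint_cross add.commute)
  \<comment> \<open>\<open>from_cross\<close> evaluates its function only at points of X, so
    agreement there suffices.\<close>
  then show "double_adjoint X dX (double_comp X dX \<rho> d) p q
      = double_comp X dX (double_adjoint X dX d) (double_adjoint X dX \<rho>) p q"
    unfolding double_adjoint_def[of X dX "double_comp X dX \<rho> d"]
      double_comp_def[of X dX "double_adjoint X dX d"]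
    by (auto simp: from_cross_def)
qed

lemma class_adjoint_mult:
  assumes M: "Metric_space X dX"
    and a: "a \<in> double_classes X dX" and b: "b \<in> double_classes X dX"
  shows "class_adjoint X dX (class_mult X dX a b)
    = class_mult X dX (class_adjoint X dX b) (class_adjoint X dX a)"
proof -
  obtain \<rho> d where "a = double_equiv X dX `` {\<rho>}" "\<rho> \<in> double_metrics X dX"
    "b = double_equiv X dX `` {d}" "d \<in> double_metrics X dX"
    using a b unfolding double_classes_def by (elim quotientE) blast
  then show ?thesis
    by (simp add: M class_mult_class class_adjoint_class double_comp_closed double_adjoint_closed
        double_adjoint_comp)
qed

text \<open>Closure lets selfadjointness be applied to the product ab itself in the commutativity
  argument.\<close>

lemma class_mult_in_double_classes:
  assumes M: "Metric_space X dX"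
    and a: "a \<in> double_classes X dX" and b: "b \<in> double_classes X dX"
  shows "class_mult X dX a b \<in> double_classes X dX"
proof -
  obtain \<rho> d where "a = double_equiv X dX `` {\<rho>}" "\<rho> \<in> double_metrics X dX"
    "b = double_equiv X dX `` {d}" "d \<in> double_metrics X dX"
    using a b unfolding double_classes_def by (elim quotientE) blast
  then show ?thesis
    unfolding double_classes_def by (simp add: M class_mult_class double_comp_closed quotientI)
qed

theorem proposition6p1:
  fixes X :: "real set"
  assumes "closed X" and "X \<subseteq> {0..}"
  shows "(\<forall>a\<in>double_classes X dist. class_adjoint X dist a = a \<and> class_mult X dist a a = a) \<and>
         (\<forall>a\<in>double_classes X dist. \<forall>b\<in>double_classes X dist.
            class_mult X dist a b = class_mult X dist b a)"
proof -
  have M: "Metric_space X dist"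
    by unfold_locales (auto simp: dist_commute dist_triangle)
  have selfadjoint_idempotent: "class_adjoint X dist a = a \<and> class_mult X dist a a = a"
    if a_in: "a \<in> double_classes X dist" for a
  proof -
    obtain d where a: "a = double_equiv X dist `` {d}" and d: "d \<in> double_metrics X dist"
      using a_in unfolding double_classes_def by (rule quotientE)
    obtain C where C: "C > 0" "\<And>x y. x \<in> X \<Longrightarrow> y \<in> X \<Longrightarrow> dist x y \<le> d (x,0) (y,1) + C"
      using half_line_dist_le_cross[OF assms(2) d] by blast
    show ?thesis
      unfolding a class_adjoint_class[OF M d] class_mult_class[OF M d d]
      using double_adjoint_equiv_self[OF M d C] double_comp_self_equiv[OF M d C]
        equiv_class_eq[OF equiv_double_equiv] by blast
  qed
  moreover have "class_mult X dist a b = class_mult X dist b a"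
    if "a \<in> double_classes X dist" "b \<in> double_classes X dist" for a b
    using class_adjoint_mult[OF M that] class_mult_in_double_classes[OF M that]
      selfadjoint_idempotent that by metis
  ultimately show ?thesis by blast
qed

end
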